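(* Any language $L\subseteq A^*$ which satisfies the ultrafilter equations $\mathcal E_{ab=ba}$, $\mathcal E_{aab=abb}$ and $\mathcal E_{a=a.a}$ for every $a,b\in A$ belongs to $\mathcal B_1$.
   Context: $A$ is a finite alphabet. For $a\in A$, $c_a(w):=\{i<|w|: w_i=a\}$; $\mathcal B_1$ is the Boolean subalgebra of $\mathcal P(A^* )$ generated by the languages $\{w: c_a(w)\cap Q\neq\emptyset\}$, $a\in A$, $Q\subseteq\mathbb N$. $\beta(S)$ is the set of ultrafilters on $S$, $\beta f(\nu):=\{P: f^{-1}(P)\in\nu\}$; $L$ satisfies $\gamma_1\leftrightarrow\gamma_2$ iff ($L\in\gamma_1\iff L\in\gamma_2$). $A^*\otimes\mathbb N^n:=\{(w,j_1,\dots,j_n): j_m<|w|\}$. $\mathcal E^{p_1,\dots,p_n}_{u=v}$ is the family of equations $\beta u(\nu)\leftrightarrow\beta v(\nu)$ for $\nu\in\beta(A^*\otimes\mathbb N^n)$ with $\beta p_1(\nu)=\dots=\beta p_n(\nu)$. $w((j_1,\dots,j_m)\to(b_1,\dots,b_m))$ replaces the letter at $j_r$ by $b_r$; $f_{a,b}(w,j_1,j_2):=w((j_1,j_2)\to(a,b))$ if $j_1\neq j_2$, else $w$; $f_{a,a,b}(w,j_1,j_2,j_3):=w((j_1,j_2,j_3)\to(a,a,b))$ if pairwise distinct, else $w$ (similarly $f_{a,b,b}$); $f_a(w,i):=w(i\to a)$, $(f_a.a)(w,i):=w(i\to a)\,a$. $\mathcal E_{ab=ba}:=\mathcal E^{\pi_1,\pi_2}_{f_{a,b}=f_{b,a}}$,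 $\mathcal E_{aab=abb}:=\mathcal E^{\pi_1,\pi_2,\pi_3}_{f_{a,a,b}=f_{a,b,b}}$, $\mathcal E_{a=a.a}:=\mathcal E^{\pi,|\cdot|}_{f_a=f_a.a}$, with $\pi_r$ coordinate projections, $\pi(w,i)=i$, $|\cdot|(w,i)=|w|$. *)

theory Defs
  imports "HOL-Analysis.Sigma_Algebra"
begin

text \<open>Words over the alphabet \<open>A\<close> are the elements of \<open>lists A\<close>; positions are counted from 0.\<close>

definition letter_positions :: "'a \<Rightarrow> 'a list \<Rightarrow> nat set"
  where "letter_positions a w = {i. i < length w \<and> w ! i = a}"

definition B1 :: "'a set \<Rightarrow> 'a list set set"
  where "B1 A = algebra (lists A) hull
           {{w \<in> lists A. letter_positions a w \<inter> Q \<noteq> {}} | a Q. a \<in> A}"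

definition ultrafilters :: "'s set \<Rightarrow> 's set set set"
  where "ultrafilters S = {U. U \<subseteq> Pow S \<and> S \<in> U \<and> {} \<notin> U
           \<and> (\<forall>X\<in>U. \<forall>Y\<in>U. X \<inter> Y \<in> U)
           \<and> (\<forall>X\<in>U. \<forall>Y. X \<subseteq> Y \<and> Y \<subseteq> S \<longrightarrow> Y \<in> U)
           \<and> (\<forall>X. X \<subseteq> S \<longrightarrow> X \<in> U \<or> S - X \<in> U)}"

text \<open>\<open>beta_map S T f\<close> is the extension \<open>\<beta>f : \<beta>(S) \<rightarrow> \<beta>(T)\<close> of \<open>f : S \<rightarrow> T\<close>.\<close>

definition beta_map :: "'s set \<Rightarrow> 't set \<Rightarrow> ('s \<Rightarrow> 't) \<Rightarrow> 's set set \<Rightarrow> 't set set"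
  where "beta_map S T f \<nu> = {P. P \<subseteq> T \<and> f -` P \<inter> S \<in> \<nu>}"

lemma beta_map_ultrafilters:
  assumes "\<nu> \<in> ultrafilters S" and f: "f \<in> S \<rightarrow> T"
  shows "beta_map S T f \<nu> \<in> ultrafilters T"
proof -
  have u: "S \<in> \<nu>" "{} \<notin> \<nu>" "\<And>X Y. X \<in> \<nu> \<Longrightarrow> Y \<in> \<nu> \<Longrightarrow> X \<inter> Y \<in> \<nu>"
    "\<And>X Y. X \<in> \<nu> \<Longrightarrow> X \<subseteq> Y \<Longrightarrow> Y \<subseteq> S \<Longrightarrow> Y \<in> \<nu>"
    "\<And>X. X \<subseteq> S \<Longrightarrow> X \<in> \<nu> \<or> S - X \<in> \<nu>"
    using assms(1) by (auto simp: ultrafilters_def)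
  have T: "f -` T \<inter> S = S" using f by auto
  have I: "f -` (X \<inter> Y) \<inter> S = (f -` X \<inter> S) \<inter> (f -` Y \<inter> S)" for X Y by auto
  have D: "f -` (T - X) \<inter> S = S - (f -` X \<inter> S)" for X using f by auto
  show ?thesis
    unfolding ultrafilters_def
  proof (intro CollectI conjI ballI allI impI)
    fix X Y assume "X \<in> beta_map S T f \<nu>" "X \<subseteq> Y \<and> Y \<subseteq> T"
    then show "Y \<in> beta_map S T f \<nu>"
      using u(4)[of "f -` X \<inter> S" "f -` Y \<inter> S"] by (auto simp: beta_map_def)
  next
    fix X assume "X \<subseteq> T"
    then show "X \<in> beta_map S T f \<nu> \<or> T - X \<in> beta_map S T f \<nu>"
      using u(5)[of "f -` X \<inter> S"] by (auto simp: beta_map_def D)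
  next
    fix X Y assume "X \<in> beta_map S T f \<nu>" "Y \<in> beta_map S T f \<nu>"
    then show "X \<inter> Y \<in> beta_map S T f \<nu>"
      using u(3)[of "f -` X \<inter> S" "f -` Y \<inter> S"] unfolding beta_map_def I[symmetric] by blast
  qed (use u(1,2) T in \<open>auto simp: beta_map_def\<close>)
qed

text \<open>The set \<open>A\<^sup>* \<otimes> \<nat>\<^sup>n\<close>; the tuple \<open>(j\<^sub>1, \<dots>, j\<^sub>n)\<close> is a list of length \<open>n\<close>.\<close>

definition marked_words :: "'a set \<Rightarrow> nat \<Rightarrow> ('a list \<times> nat list) set"
  where "marked_words A n =
           {(w, js). w \<in> lists A \<and> length js = n \<and> (\<forall>j\<in>set js. j < length w)}"

text \<open>\<open>coord r\<close> is the coordinate projection \<open>\<pi>\<^sub>r\<^sub>+\<^sub>1\<close>.\<close>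

definition coord :: "nat \<Rightarrow> 'a list \<times> nat list \<Rightarrow> nat"
  where "coord r = (\<lambda>(w, js). js ! r)"

definition word_length :: "'a list \<times> nat list \<Rightarrow> nat"
  where "word_length = (\<lambda>(w, js). length w)"

definition replace_letters :: "'a list \<Rightarrow> nat list \<Rightarrow> 'a list \<Rightarrow> 'a list"
  where "replace_letters w js bs = fold (\<lambda>(j, b) v. v[j := b]) (zip js bs) w"

text \<open>\<open>letter_subst [b\<^sub>1, \<dots>, b\<^sub>n]\<close> is the map \<open>f\<close> with index \<open>b\<^sub>1, \<dots>, b\<^sub>n\<close>; for \<open>n = 1\<close> the
  distinctness condition is vacuous.\<close>

definition letter_subst :: "'a list \<Rightarrow> 'a list \<times> nat list \<Rightarrow> 'a list"
  where "letter_subst bs = (\<lambda>(w, js). if distinct js then replace_letters w js bs else w)"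

text \<open>An equation \<open>\<gamma>\<^sub>1 \<leftrightarrow> \<gamma>\<^sub>2\<close> is the pair \<open>(\<gamma>\<^sub>1, \<gamma>\<^sub>2)\<close>.\<close>

definition satisfies :: "'a list set \<Rightarrow> ('a list set set \<times> 'a list set set) set \<Rightarrow> bool"
  where "satisfies L E \<longleftrightarrow> (\<forall>(\<gamma>\<^sub>1, \<gamma>\<^sub>2)\<in>E. L \<in> \<gamma>\<^sub>1 \<longleftrightarrow> L \<in> \<gamma>\<^sub>2)"

text \<open>The number \<open>n\<close> of marked positions is independent of the number of maps \<open>ps\<close>.\<close>

definition ultrafilter_eqs ::
    "'a set \<Rightarrow> nat \<Rightarrow> ('a list \<times> nat list \<Rightarrow> nat) list
     \<Rightarrow> ('a list \<times> nat list \<Rightarrow> 'a list) \<Rightarrow> ('a list \<times> nat list \<Rightarrow> 'a list)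
     \<Rightarrow> ('a list set set \<times> 'a list set set) set"
  where "ultrafilter_eqs A n ps u v =
           {(beta_map (marked_words A n) (lists A) u \<nu>,
             beta_map (marked_words A n) (lists A) v \<nu>) | \<nu>.
              \<nu> \<in> ultrafilters (marked_words A n) \<and>
              (\<forall>p\<in>set ps. \<forall>q\<in>set ps.
                 beta_map (marked_words A n) UNIV p \<nu> = beta_map (marked_words A n) UNIV q \<nu>)}"

definition E_ab_ba :: "'a set \<Rightarrow> 'a \<Rightarrow> 'a \<Rightarrow> ('a list set set \<times> 'a list set set) set"
  where "E_ab_ba A a b =
           ultrafilter_eqs A 2 [coord 0, coord 1] (letter_subst [a, b]) (letter_subst [b, a])"

definition E_aab_abb :: "'a set \<Rightarrow> 'a \<Rightarrow> 'a \<Rightarrow> ('a list set set \<times> 'a list set set) set"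
  where "E_aab_abb A a b =
           ultrafilter_eqs A 3 [coord 0, coord 1, coord 2]
             (letter_subst [a, a, b]) (letter_subst [a, b, b])"

definition E_a_aa :: "'a set \<Rightarrow> 'a \<Rightarrow> ('a list set set \<times> 'a list set set) set"
  where "E_a_aa A a =
           ultrafilter_eqs A 1 [coord 0, word_length]
             (letter_subst [a]) (\<lambda>x. letter_subst [a] x @ [a])"

end

theory Submission
  imports Defs
begin

text \<open>
  By compactness of the space of ultrafilters, the equations together amount to a
  statement about one finite colouring \<open>c\<close> of \<open>\<nat>\<close>: membership in \<open>L\<close> is not changed by swapping
  two letters at positions of equal colour, by turning \<open>aab\<close> into \<open>abb\<close> at positions of equal
  colour, nor by appending a letter that already occurs at a position with the colour of the new
  one. Hence, for words long enough to have seen all colours, membership depends only on the set of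
  pairs (letter, colour) that occur. The finitely many shorter words are singled out by the
  sets \<open>Q = {i}\<close>.
\<close>

section \<open>Ultrafilters and compactness\<close>

text \<open>Zorn's lemma yields a maximal family above \<open>B\<close> with the finite intersection
  property, and maximality makes it an ultrafilter. Intersecting with \<open>S\<close> covers the
  empty \<open>F\<close>, for which the condition says that \<open>S\<close> is nonempty.\<close>

lemma ultrafilter_extending:
  assumes B: "B \<subseteq> Pow S"
    and fip: "\<forall>F. finite F \<longrightarrow> F \<subseteq> B \<longrightarrow> S \<inter> \<Inter>F \<noteq> {}"
  shows "\<exists>U\<in>ultrafilters S. B \<subseteq> U"
proof -
  define \<F> where
    "\<F> = {U. B \<subseteq> U \<and> U \<subseteq> Pow S \<and> (\<forall>F. finite F \<longrightarrow> F \<subseteq> U \<longrightarrow> S \<inter> \<Inter>F \<noteq> {})}"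
  have "B \<in> \<F>" using assms by (auto simp: \<F>_def)
  moreover have "\<Union>C \<in> \<F>" if "C \<noteq> {}" and ch: "subset.chain \<F> C" for C
  proof -
    have C: "C \<subseteq> \<F>" using ch by (simp add: subset.chain_def)
    have "S \<inter> \<Inter>F \<noteq> {}" if F: "finite F" "F \<subseteq> \<Union>C" for F
    proof -
      obtain U where "U \<in> C" "F \<subseteq> U"
        using finite_subset_Union_chain[OF F \<open>C \<noteq> {}\<close> ch] by blast
      then show ?thesis using C F(1) by (auto simp: \<F>_def)
    qed
    moreover have "B \<subseteq> \<Union>C" "\<Union>C \<subseteq> Pow S"
      using C \<open>C \<noteq> {}\<close> unfolding \<F>_def by blast+
    ultimately show ?thesis by (simp add: \<F>_def)
  qed
  ultimately obtain U where U: "U \<in> \<F>" and max: "\<And>V. V \<in> \<F> \<Longrightarrow> U \<subseteq> V \<Longrightarrow> V = U"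
    using subset_Zorn_nonempty[of \<F>] by blast
  have BU: "B \<subseteq> U" "U \<subseteq> Pow S" and Ufip: "\<And>F. finite F \<Longrightarrow> F \<subseteq> U \<Longrightarrow> S \<inter> \<Inter>F \<noteq> {}"
    using U by (auto simp: \<F>_def)
  \<comment> \<open>Adjoining such an \<open>X\<close> keeps the finite intersection property, so
    maximality forces it to be in \<open>U\<close> already.\<close>
  have mem: "X \<in> U" if X: "X \<subseteq> S" and *: "\<And>F. finite F \<Longrightarrow> F \<subseteq> U \<Longrightarrow> S \<inter> \<Inter>F \<inter> X \<noteq> {}" for X
  proof -
    have "S \<inter> \<Inter>F \<noteq> {}" if "finite F" "F \<subseteq> insert X U" for F
      using *[of "F - {X}"] that by blast
    then have "insert X U \<in> \<F>" using X BU by (auto simp: \<F>_def)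
    then show ?thesis using max[of "insert X U"] by blast
  qed
  \<comment> \<open>This one closure property specialises to \<open>S \<in> U\<close>, binary
    intersections and supersets; with \<open>mem\<close> it also decides between \<open>X\<close>
    and its complement.\<close>
  have up: "Y \<in> U" if F: "finite F" "F \<subseteq> U" "S \<inter> \<Inter>F \<subseteq> Y" "Y \<subseteq> S" for F Y
  proof (rule mem)
    fix G assume "finite G" "G \<subseteq> U"
    then have "S \<inter> \<Inter>(F \<union> G) \<noteq> {}" using F by (intro Ufip) auto
    then show "S \<inter> \<Inter>G \<inter> Y \<noteq> {}" using F(3) by blast
  qed (fact F(4))
  have "X \<in> U \<or> S - X \<in> U" if X: "X \<subseteq> S" for X
  proof (rule disjCI)
    assume "S - X \<notin> U"
    then obtain F where F: "finite F" "F \<subseteq> U" "S \<inter> \<Inter>F \<inter> (S - X) = {}"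
      using mem[of "S - X"] by blast
    then show "X \<in> U" using up[of F X] X by blast
  qed
  moreover have "S \<in> U" using up[of "{}" S] by simp
  moreover have "{} \<notin> U" using Ufip[of "{{}}"] by auto
  moreover have "X \<inter> Y \<in> U" if "X \<in> U" "Y \<in> U" for X Y
    using up[of "{X, Y}" "X \<inter> Y"] that BU(2) by auto
  moreover have "Y \<in> U" if "X \<in> U" "X \<subseteq> Y" "Y \<subseteq> S" for X Y
    using up[of "{X}" Y] that by auto
  ultimately have "U \<in> ultrafilters S"
    using BU(2) unfolding ultrafilters_def by blast
  then show ?thesis using BU(1) by (rule rev_bexI)
qed

text \<open>Compactness turns the equations into a finite condition. If every finite family failed,
  the set \<open>D\<close> of counterexamples together with all the sets \<open>E Q\<close> would
  have the finite intersection property. An ultrafilter containing them equalises the maps in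
  \<open>ps\<close> and yet violates the equation.\<close>

lemma ultrafilter_eqs_finite_family:
  assumes sat: "satisfies L (ultrafilter_eqs A n ps u v)" and L: "L \<subseteq> lists A"
  shows "\<exists>\<Q>. finite \<Q> \<and> (\<forall>x \<in> marked_words A n.
           (\<forall>Q\<in>\<Q>. \<forall>p\<in>set ps. \<forall>q\<in>set ps. p x \<in> Q \<longleftrightarrow> q x \<in> Q) \<longrightarrow> (u x \<in> L \<longleftrightarrow> v x \<in> L))"
proof (rule ccontr)
  assume neg: "\<not> ?thesis"
  define S where "S = marked_words A n"
  define D where "D = {x \<in> S. \<not> (u x \<in> L \<longleftrightarrow> v x \<in> L)}"
  define E where "E Q = {x \<in> S. \<forall>p\<in>set ps. \<forall>q\<in>set ps. p x \<in> Q \<longleftrightarrow> q x \<in> Q}" for Q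
  have "S \<inter> \<Inter>F \<noteq> {}" if "finite F" "F \<subseteq> insert D (range E)" for F
  proof -
    from that have "finite (F - {D})" "F - {D} \<subseteq> range E" by auto
    then obtain \<Q> where \<Q>: "finite \<Q>" "F - {D} = E ` \<Q>"
      by (metis finite_subset_image)
    obtain x where "x \<in> S" "\<forall>Q\<in>\<Q>. x \<in> E Q" "x \<in> D"
      using not_ex[THEN iffD1, OF neg, THEN spec, of \<Q>] \<Q>(1)
      by (auto simp: S_def D_def E_def)
    moreover from this have "x \<in> X" if "X \<in> F" for X
      using \<Q>(2) that by (cases "X = D") auto
    ultimately show ?thesis by blast
  qed
  moreover have "insert D (range E) \<subseteq> Pow S" by (auto simp: D_def E_def)
  ultimately have "\<exists>\<nu>\<in>ultrafilters S. insert D (range E) \<subseteq> \<nu>"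
    by (intro ultrafilter_extending allI impI)
  then obtain \<nu> where \<nu>: "\<nu> \<in> ultrafilters S" and "insert D (range E) \<subseteq> \<nu>" ..
  then have D: "D \<in> \<nu>" and E: "\<And>Q. E Q \<in> \<nu>" by auto
  have inter: "X \<inter> Y \<in> \<nu>" if "X \<in> \<nu>" "Y \<in> \<nu>" for X Y
    using \<nu> that unfolding ultrafilters_def by blast
  have up: "Y \<in> \<nu>" if "X \<in> \<nu>" "X \<subseteq> Y" "Y \<subseteq> S" for X Y
    using \<nu> that unfolding ultrafilters_def by blast
  have ultra: "X \<in> \<nu> \<or> S - X \<in> \<nu>" if "X \<subseteq> S" for X
    using \<nu> that unfolding ultrafilters_def by blast
  have "{} \<notin> \<nu>" using \<nu> unfolding ultrafilters_def by blast
  \<comment> \<open>An inclusion suffices, since \<open>p\<close> and \<open>q\<close> may be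
    exchanged.\<close>
  have le: "beta_map S UNIV p \<nu> \<subseteq> beta_map S UNIV q \<nu>" if "p \<in> set ps" "q \<in> set ps" for p q
  proof
    fix P assume "P \<in> beta_map S UNIV p \<nu>"
    then have "(p -` P \<inter> S) \<inter> E P \<in> \<nu>" using inter E by (auto simp: beta_map_def)
    then have "q -` P \<inter> S \<in> \<nu>" by (rule up) (use that in \<open>auto simp: E_def\<close>)
    then show "P \<in> beta_map S UNIV q \<nu>" by (simp add: beta_map_def)
  qed
  then have "(beta_map S (lists A) u \<nu>, beta_map S (lists A) v \<nu>) \<in> ultrafilter_eqs A n ps u v"
    unfolding ultrafilter_eqs_def S_def[symmetric] using \<nu> by blast
  then have eq: "u -` L \<inter> S \<in> \<nu> \<longleftrightarrow> v -` L \<inter> S \<in> \<nu>"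
    using sat L by (auto simp: satisfies_def beta_map_def)
  show False
  proof (cases "u -` L \<inter> S \<in> \<nu>")
    case True
    then have "(u -` L \<inter> S) \<inter> (v -` L \<inter> S) \<inter> D \<in> \<nu>" using eq inter D by blast
    moreover have "(u -` L \<inter> S) \<inter> (v -` L \<inter> S) \<inter> D = {}" by (auto simp: D_def)
    ultimately show False using \<open>{} \<notin> \<nu>\<close> by simp
  next
    case False
    then have "(S - (u -` L \<inter> S)) \<inter> (S - (v -` L \<inter> S)) \<inter> D \<in> \<nu>"
      using eq inter D ultra by (metis Int_lower2)
    moreover have "(S - (u -` L \<inter> S)) \<inter> (S - (v -` L \<inter> S)) \<inter> D = {}" by (auto simp: D_def)
    ultimately show False using \<open>{} \<notin> \<nu>\<close> by simp
  qed
qed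

text \<open>The union of the finitely many families works for all indices at once, because enlarging
  a family only strengthens the premise.\<close>

corollary ultrafilter_eqs_uniform_finite_family:
  assumes I: "finite I" and L: "L \<subseteq> lists A"
    and sat: "\<forall>i\<in>I. satisfies L (ultrafilter_eqs A n ps (u i) (v i))"
  shows "\<exists>\<Q>. finite \<Q> \<and> (\<forall>i\<in>I. \<forall>x \<in> marked_words A n.
           (\<forall>Q\<in>\<Q>. \<forall>p\<in>set ps. \<forall>q\<in>set ps. p x \<in> Q \<longleftrightarrow> q x \<in> Q) \<longrightarrow> (u i x \<in> L \<longleftrightarrow> v i x \<in> L))"
proof -
  have "\<forall>i\<in>I. \<exists>\<Q>. finite \<Q> \<and> (\<forall>x \<in> marked_words A n.
      (\<forall>Q\<in>\<Q>. \<forall>p\<in>set ps. \<forall>q\<in>set ps. p x \<in> Q \<longleftrightarrow> q x \<in> Q) \<longrightarrow> (u i x \<in> L \<longleftrightarrow> v i x \<in> L))"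
    using ultrafilter_eqs_finite_family[OF bspec[OF sat] L] by (rule ballI)
  then obtain R where R: "\<forall>i\<in>I. finite (R i) \<and> (\<forall>x \<in> marked_words A n.
      (\<forall>Q\<in>R i. \<forall>p\<in>set ps. \<forall>q\<in>set ps. p x \<in> Q \<longleftrightarrow> q x \<in> Q) \<longrightarrow> (u i x \<in> L \<longleftrightarrow> v i x \<in> L))"
    unfolding bchoice_iff by blast
  show ?thesis
  proof (intro exI[of _ "\<Union>(R ` I)"] conjI ballI impI)
    show "finite (\<Union>(R ` I))" using I R by blast
  next
    fix i x
    assume i: "i \<in> I" and x: "x \<in> marked_words A n"
      and eq: "\<forall>Q\<in>\<Union>(R ` I). \<forall>p\<in>set ps. \<forall>q\<in>set ps. p x \<in> Q \<longleftrightarrow> q x \<in> Q"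
    have "\<forall>Q\<in>R i. \<forall>p\<in>set ps. \<forall>q\<in>set ps. p x \<in> Q \<longleftrightarrow> q x \<in> Q"
      using i by (intro ballI eq[rule_format]) auto
    then show "u i x \<in> L \<longleftrightarrow> v i x \<in> L"
      using bspec[OF conjunct2[OF bspec[OF R i]] x] by (rule mp[rotated])
  qed
qed

section \<open>Saturated sets in Boolean algebras\<close>

text \<open>Finitely many sets generate a finite Boolean algebra, and \<open>L\<close> is a union of
  its atoms. Induction on \<open>G\<close> avoids naming the atoms.\<close>

lemma (in algebra) saturated_in_sets:
  assumes "finite G" "G \<subseteq> M" "L \<subseteq> \<Omega>"
    and "\<And>x y. x \<in> \<Omega> \<Longrightarrow> y \<in> \<Omega> \<Longrightarrow> (\<forall>g\<in>G. x \<in> g \<longleftrightarrow> y \<in> g) \<Longrightarrow> x \<in> L \<Longrightarrow> y \<in> L"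
  shows "L \<in> M"
  using assms
proof (induction G arbitrary: L rule: finite_induct)
  case empty
  then have "L = {} \<or> L = \<Omega>" by blast
  then show ?case by auto
next
  case (insert g G)
  \<comment> \<open>\<open>cl X\<close> is the saturation of \<open>X\<close> for the smaller family
    \<open>G\<close>, so the induction hypothesis applies to it. \<open>L\<close> is then recovered
    by treating its parts inside and outside \<open>g\<close> separately.\<close>
  define cl where "cl X = {x \<in> \<Omega>. \<exists>y\<in>X. \<forall>h\<in>G. x \<in> h \<longleftrightarrow> y \<in> h}" for X
  have "cl X \<in> M" for X
    by (rule insert.IH) (use insert.prems in \<open>auto simp: cl_def\<close>)
  moreover have "g \<in> M" using insert.prems by simp
  moreover have "L = (cl (L \<inter> g) \<inter> g) \<union> (cl (L - g) - g)"
  proof (intro equalityI subsetI)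
    fix x assume "x \<in> L"
    then show "x \<in> (cl (L \<inter> g) \<inter> g) \<union> (cl (L - g) - g)"
      using insert.prems(2) by (auto simp: cl_def)
  next
    fix x assume "x \<in> (cl (L \<inter> g) \<inter> g) \<union> (cl (L - g) - g)"
    then obtain y where "x \<in> \<Omega>" "y \<in> L" "\<forall>h\<in>insert g G. y \<in> h \<longleftrightarrow> x \<in> h"
      by (auto simp: cl_def)
    then show "x \<in> L" using insert.prems(3)[of y x] insert.prems(2) by blast
  qed
  ultimately show ?case by (metis Diff Un Int)
qed

text \<open>An intersection of algebras is again an algebra; that it consists of subsets of the base
  set comes from \<open>Pow \<Omega>\<close> being one of those intersected.\<close>

lemma algebra_hull:
  assumes "G \<subseteq> Pow \<Omega>"
  shows "algebra \<Omega> (algebra \<Omega> hull G)"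
proof -
  have "algebra \<Omega> hull G \<subseteq> Pow \<Omega>"
    using assms by (intro hull_minimal sigma_algebra.axioms(1) sigma_algebra_Pow)
  then show ?thesis
    by (intro algebra_iff_Int[THEN iffD2])
       (auto simp: hull_def algebra_iff_Int)
qed

section \<open>Words over a coloured set of positions\<close>

definition letter_types :: "(nat \<Rightarrow> 'c) \<Rightarrow> 'a list \<Rightarrow> ('a \<times> 'c) set"
  where "letter_types c w = (\<lambda>i. (w ! i, c i)) ` {..<length w}"

text \<open>The combinatorial form of the three equations. The letters of \<open>w\<close> at the
  overwritten positions are arbitrary, as in the substitution maps.\<close>

locale invariant_colouring =
  fixes A :: "'a set" and L :: "'a list set" and c :: "nat \<Rightarrow> 'c"
  assumes swap: "\<And>w a b i j. \<lbrakk>w \<in> lists A; a \<in> A; b \<in> A; i < length w; j < length w; i \<noteq> j; c i = c j\<rbrakk>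
      \<Longrightarrow> w[i := a, j := b] \<in> L \<longleftrightarrow> w[i := b, j := a] \<in> L"
    and shift: "\<And>w a b i j k. \<lbrakk>w \<in> lists A; a \<in> A; b \<in> A; i < length w; j < length w; k < length w;
        distinct [i, j, k]; c i = c j; c j = c k\<rbrakk>
      \<Longrightarrow> w[i := a, j := a, k := b] \<in> L \<longleftrightarrow> w[i := a, j := b, k := b] \<in> L"
    and append: "\<And>w a i. \<lbrakk>w \<in> lists A; a \<in> A; i < length w; c i = c (length w)\<rbrakk>
      \<Longrightarrow> w[i := a] \<in> L \<longleftrightarrow> w[i := a] @ [a] \<in> L"
begin

text \<open>Induction on the number of positions where \<open>x\<close> and \<open>y\<close> differ:
  each round changes \<open>x\<close> by swaps and shifts, keeps its types, repairs one position and
  spoils no position that already agrees.\<close>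

lemma same_length_types:
  assumes "x \<in> lists A" "y \<in> lists A" "length x = length y"
    "letter_types c x = letter_types c y"
  shows "x \<in> L \<longleftrightarrow> y \<in> L"
  using assms
proof (induction "card {i. i < length x \<and> x ! i \<noteq> y ! i}" arbitrary: x rule: less_induct)
  case less
  show ?case
  proof (cases "x = y")
    case False
    then obtain i where i: "i < length x" "x ! i \<noteq> y ! i"
      using less.prems(3) by (auto simp: list_eq_iff_nth_eq)
    define a b where "a = x ! i" and "b = y ! i"
    have ab: "a \<in> A" "b \<in> A" "a \<noteq> b"
      using less.prems i by (auto simp: a_def b_def)
    have reduce: "x' \<in> L \<longleftrightarrow> y \<in> L"
      if "x' \<in> lists A" "length x' = length x" "letter_types c x' = letter_types c x"
        "m < length x" "x ! m \<noteq> y ! m" "x' ! m = y ! m"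
        "\<And>l. l < length x \<Longrightarrow> x ! l = y ! l \<Longrightarrow> x' ! l = y ! l" for x' m
    proof (rule less.hyps)
      show "card {i. i < length x' \<and> x' ! i \<noteq> y ! i} < card {i. i < length x \<and> x ! i \<noteq> y ! i}"
        by (rule psubset_card_mono) (use that in auto)
    qed (use that less.prems in auto)
    \<comment> \<open>Equality of types supplies two positions of the colour of \<open>i\<close>:
      \<open>k0\<close>, where \<open>y\<close> has the letter \<open>a\<close>, and
      \<open>j\<close>, where \<open>x\<close> has the letter \<open>b\<close>.\<close>
    have "(a, c i) \<in> letter_types c y"
      using i less.prems(4) by (force simp: letter_types_def a_def)
    then obtain k0 where k0: "k0 < length x" "y ! k0 = a" "c k0 = c i"
      using less.prems(3) by (auto simp: letter_types_def)
    have "(b, c i) \<in> letter_types c x"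
      using i less.prems(3,4) by (force simp: letter_types_def b_def)
    then obtain j where j: "j < length x" "x ! j = b" "c j = c i"
      by (auto simp: letter_types_def)
    show ?thesis
    proof (cases "x ! k0 = a")
      case False
      \<comment> \<open>Here \<open>k0\<close> is a mismatch too, and swapping the letters of
        \<open>x\<close> at \<open>i\<close> and \<open>k0\<close> repairs it.\<close>
      define d where "d = x ! k0"
      have d: "d \<in> A" using less.prems(1) k0 by (auto simp: d_def)
      have ik: "i \<noteq> k0" using False by (auto simp: a_def)
      define x' where "x' = x[i := d, k0 := a]"
      have "x = x[i := a, k0 := d]" by (simp add: a_def d_def)
      then have "x \<in> L \<longleftrightarrow> x' \<in> L"
        using swap[of x a d i k0] less.prems(1) ab d i k0 ik by (simp add: x'_def)
      moreover have "x' \<in> L \<longleftrightarrow> y \<in> L"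
      proof (rule reduce[where m = k0])
        show "x' \<in> lists A"
          using less.prems(1) ab d unfolding x'_def lists_eq_set
          by (auto dest!: set_update_subset_insert[THEN subsetD])
        \<comment> \<open>\<open>x'\<close> is \<open>x\<close> composed with the transposition of
          \<open>i\<close> and \<open>k0\<close>, which preserves colours and permutes the
          positions.\<close>
        have nth: "(x' ! l, c l) = (x ! (if l = i then k0 else if l = k0 then i else l),
            c (if l = i then k0 else if l = k0 then i else l))" if "l < length x" for l
          using that k0 by (auto simp: x'_def nth_list_update a_def d_def)
        have bij: "(\<lambda>l. if l = i then k0 else if l = k0 then i else l) ` {..<length x} = {..<length x}"
          using i(1) k0(1) by (auto simp: image_iff)
        have "letter_types c x' = (\<lambda>l. (x ! l, c l)) `
            (\<lambda>l. if l = i then k0 else if l = k0 then i else l) ` {..<length x}"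
          unfolding letter_types_def image_image
          by (rule image_cong) (use nth in \<open>auto simp: x'_def\<close>)
        then show "letter_types c x' = letter_types c x"
          unfolding bij by (simp add: letter_types_def)
        show "x' ! l = y ! l" if "l < length x" "x ! l = y ! l" for l
          using that i k0 by (auto simp: x'_def nth_list_update)
      qed (use k0 False in \<open>auto simp: x'_def\<close>)
      ultimately show ?thesis by simp
    next
      case True
      \<comment> \<open>Now \<open>x\<close> reads \<open>a\<close>, \<open>a\<close>,
        \<open>b\<close> at \<open>i\<close>, \<open>k0\<close>, \<open>j\<close>. A shift gives
        \<open>a\<close>, \<open>b\<close>, \<open>b\<close>, and swapping the first two gives
        \<open>b\<close>, \<open>a\<close>, \<open>b\<close>; the net effect is to repair
        \<open>i\<close> alone.\<close>
      define x' where "x' = x[i := b]"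
      have dist: "distinct [i, k0, j]"
        using True k0 j ab by (auto simp: a_def b_def)
      have e1: "x = x[i := a, k0 := a, j := b]" using True j(2) by (metis a_def list_update_id)
      have e2: "x' = (x[j := b])[i := b, k0 := a]"
        using True i j k0 dist by (auto simp: x'_def nth_list_update list_eq_iff_nth_eq)
      have e3: "x[i := a, k0 := b, j := b] = (x[j := b])[i := a, k0 := b]"
        using i j k0 dist by (auto simp: nth_list_update list_eq_iff_nth_eq)
      have xj: "x[j := b] = x" using j by auto
      have "x \<in> L \<longleftrightarrow> x[i := a, k0 := b, j := b] \<in> L"
        using shift[of x a b i k0 j] e1 less.prems(1) ab i k0 j dist by simp
      also have "\<dots> \<longleftrightarrow> x' \<in> L"
        unfolding e2 e3 xj using swap[of x a b i k0] less.prems(1) ab i k0 dist by simp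
      also have "\<dots> \<longleftrightarrow> y \<in> L"
      proof (rule reduce[where m = i])
        show "x' \<in> lists A"
          using less.prems(1) ab unfolding x'_def lists_eq_set
          by (auto dest!: set_update_subset_insert[THEN subsetD])
        \<comment> \<open>Only position \<open>i\<close> changes: the new pair
          \<open>(b, c i)\<close> already occurs at \<open>j\<close>, and the lost pair
          \<open>(a, c i)\<close> survives at \<open>k0\<close>.\<close>
        show "letter_types c x' = letter_types c x"
        proof (intro equalityI subsetI)
          fix z assume "z \<in> letter_types c x'"
          then obtain l where l: "l < length x" "z = (x' ! l, c l)"
            by (auto simp: letter_types_def x'_def)
          have "z = (x ! (if l = i then j else l), c (if l = i then j else l))"
            using l j by (auto simp: x'_def)
          then show "z \<in> letter_types c x"
            unfolding letter_types_def by (rule image_eqI) (use l j in simp)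
        next
          fix z assume "z \<in> letter_types c x"
          then obtain l where l: "l < length x" "z = (x ! l, c l)"
            by (auto simp: letter_types_def)
          have "z = (x' ! (if l = i then k0 else l), c (if l = i then k0 else l))"
            using l k0 True dist by (auto simp: x'_def a_def)
          then show "z \<in> letter_types c x'"
            unfolding letter_types_def by (rule image_eqI) (use l k0 in \<open>simp add: x'_def\<close>)
        qed
        show "x' ! l = y ! l" if "l < length x" "x ! l = y ! l" for l
          using that i by (auto simp: x'_def nth_list_update)
      qed (use i in \<open>auto simp: x'_def b_def\<close>)
      finally show ?thesis .
    qed
  qed simp
qed

text \<open>Every colour has a representative below \<open>N\<close>, so the letter found there can
  be appended at a position of the same colour without creating a new pair.\<close>

lemma extend_word:
  assumes N: "\<And>n. \<exists>i<N. c i = c n" and x: "x \<in> lists A" "N \<le> length x" and m: "length x \<le> m"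
  shows "\<exists>z\<in>lists A. length z = m \<and> letter_types c z = letter_types c x \<and> (z \<in> L \<longleftrightarrow> x \<in> L)"
  using m
proof (induction m rule: dec_induct)
  case base
  then show ?case using x by blast
next
  case (step m)
  then obtain z where z: "z \<in> lists A" "length z = m"
    "letter_types c z = letter_types c x" "z \<in> L \<longleftrightarrow> x \<in> L" by blast
  obtain i where i: "i < N" "c i = c m" using N by blast
  then have im: "i < m" using x(2) step.hyps by simp
  have a: "z ! i \<in> A" using z im by auto
  \<comment> \<open>Overwriting position \<open>i\<close> with its own letter leaves
    \<open>z\<close> unchanged, so \<open>append\<close> compares \<open>z\<close> with its
    extension.\<close>
  have "z \<in> L \<longleftrightarrow> z @ [z ! i] \<in> L"
    using append[of z "z ! i" i] z im i a by simp
  moreover have "letter_types c (z @ [z ! i]) = insert (z ! i, c m) (letter_types c z)"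
    using z(2) by (auto simp: letter_types_def lessThan_Suc nth_append)
  moreover have "(z ! i, c m) \<in> letter_types c z"
    using im z(2) i(2) by (force simp: letter_types_def)
  ultimately show ?case
    using z a by (intro bexI[of _ "z @ [z ! i]"]) (auto simp: insert_absorb)
qed

text \<open>Both words are padded to a common length, which reduces the claim to
  \<open>same_length_types\<close>.\<close>

lemma same_types:
  assumes N: "\<And>n. \<exists>i<N. c i = c n"
    and x: "x \<in> lists A" "N \<le> length x" and y: "y \<in> lists A" "N \<le> length y"
    and eq: "letter_types c x = letter_types c y"
  shows "x \<in> L \<longleftrightarrow> y \<in> L"
proof -
  define m where "m = max (length x) (length y)"
  obtain x' where x': "x' \<in> lists A" "length x' = m" "letter_types c x' = letter_types c x"
      "x' \<in> L \<longleftrightarrow> x \<in> L"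
    using extend_word[OF N x, of m] by (auto simp: m_def)
  obtain y' where y': "y' \<in> lists A" "length y' = m" "letter_types c y' = letter_types c y"
      "y' \<in> L \<longleftrightarrow> y \<in> L"
    using extend_word[OF N y, of m] by (auto simp: m_def)
  show ?thesis using same_length_types[of x' y'] x' y' eq by simp
qed

text \<open>\<open>L\<close> is saturated for a finite set of generators. Colour classes detect the
  types, which decide membership for long words; singletons below \<open>N\<close> determine short
  words completely.\<close>

lemma in_B1:
  assumes "finite A" "L \<subseteq> lists A" "finite (range c)"
  shows "L \<in> B1 A"
proof -
  obtain I where I: "finite I" "range c = c ` I"
    using finite_subset_image[of "range c" c UNIV] assms(3) by auto
  \<comment> \<open>\<open>N\<close> bounds a finite set \<open>I\<close> of representatives of the
    colours.\<close>
  obtain N where "\<And>i. i \<in> I \<Longrightarrow> i < N"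
    using I(1) finite_nat_set_iff_bounded by auto
  then have N: "\<exists>i<N. c i = c n" for n
    using I(2) by (metis imageE rangeI)
  define gen where "gen = (\<lambda>(a, Q). {w \<in> lists A. letter_positions a w \<inter> Q \<noteq> {}})"
  define \<Q> where "\<Q> = (\<lambda>q. c -` {q}) ` range c \<union> (\<lambda>i. {i}) ` {..<N}"
  define G where "G = gen ` (A \<times> \<Q>)"
  define B where "B = {{w \<in> lists A. letter_positions a w \<inter> Q \<noteq> {}} | a Q. a \<in> A}"
  interpret algebra "lists A" "B1 A"
    unfolding B1_def by (rule algebra_hull) auto
  have "G \<subseteq> B1 A"
  proof -
    have "G \<subseteq> B" by (auto simp: G_def B_def gen_def)
    also have "B \<subseteq> B1 A" unfolding B1_def B_def by (rule hull_subset)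
    finally show ?thesis .
  qed
  moreover have "finite G" using assms by (auto simp: G_def \<Q>_def)
  moreover have "y \<in> L" if xy: "x \<in> lists A" "y \<in> lists A" "\<forall>g\<in>G. x \<in> g \<longleftrightarrow> y \<in> g" "x \<in> L" for x y
  proof -
    have agree: "letter_positions a x \<inter> Q \<noteq> {} \<longleftrightarrow> letter_positions a y \<inter> Q \<noteq> {}"
      if "a \<in> A" "Q \<in> \<Q>" for a Q
      using xy that by (auto simp: G_def gen_def)
    have pos: "i < length x \<and> x ! i = a \<longleftrightarrow> i < length y \<and> y ! i = a" if "a \<in> A" "i < N" for a i
      using agree[of a "{i}"] that by (auto simp: \<Q>_def letter_positions_def)
    \<comment> \<open>A position below \<open>N\<close> exists in a word exactly when some letter of
      \<open>A\<close> stands there, so the singletons also detect lengths below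
      \<open>N\<close>.\<close>
    have len: "i < length x \<longleftrightarrow> i < length y" if "i < N" for i
      using pos[of _ i] that xy(1,2) by (metis in_lists_conv_set nth_mem)
    show ?thesis
    proof (cases "N \<le> length x \<and> N \<le> length y")
      case True
      have "(a, q) \<in> letter_types c x \<longleftrightarrow> (a, q) \<in> letter_types c y" for a q
      proof (cases "a \<in> A \<and> q \<in> range c")
        case True
        have *: "(a, q) \<in> letter_types c w \<longleftrightarrow> letter_positions a w \<inter> c -` {q} \<noteq> {}" for w
          by (auto simp: letter_types_def letter_positions_def)
        show ?thesis unfolding * using True agree[of a "c -` {q}"] by (auto simp: \<Q>_def)
      next
        case False
        then show ?thesis using xy(1,2) by (auto simp: letter_types_def)
      qed
      then have "letter_types c x = letter_types c y" by auto
      then show ?thesis using same_types[OF N] True xy by blast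
    next
      case False
      \<comment> \<open>The shorter length is below \<open>N\<close>; applying \<open>len\<close> at
        that position rules out that the other word is longer.\<close>
      then have "length x = length y" "length x < N"
        using len[of "length x"] len[of "length y"] by (metis le_less_linear linorder_neq_iff less_trans)+
      moreover have "x ! i = y ! i" if "i < length x" for i
        using pos[of "x ! i" i] that xy(1) \<open>length x < N\<close> by auto
      ultimately have "x = y" by (simp add: list_eq_iff_nth_eq)
      then show ?thesis using xy by simp
    qed
  qed
  ultimately show ?thesis using saturated_in_sets[of G L] assms(2) by blast
qed

end

section \<open>From the equations to a colouring\<close>

theorem mainTheorem16:
  fixes A :: "'a set" and L :: "'a list set"
  assumes "finite A"
    and "L \<subseteq> lists A"
    and "\<And>a b. a \<in> A \<Longrightarrow> b \<in> A \<Longrightarrow> satisfies L (E_ab_ba A a b)"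
    and "\<And>a b. a \<in> A \<Longrightarrow> b \<in> A \<Longrightarrow> satisfies L (E_aab_abb A a b)"
    and "\<And>a. a \<in> A \<Longrightarrow> satisfies L (E_a_aa A a)"
  shows "L \<in> B1 A"
proof -
  \<comment> \<open>Finiteness of the alphabet gives one finite family for all pairs of letters
    \<open>z\<close>.\<close>
  have finAA: "finite (A \<times> A)" using assms(1) by simp
  have sat2: "\<forall>z\<in>A \<times> A. satisfies L (ultrafilter_eqs A 2 [coord 0, coord 1]
      (letter_subst [fst z, snd z]) (letter_subst [snd z, fst z]))"
    using assms(3) by (auto simp: E_ab_ba_def)
  obtain Q2 where Q2: "finite Q2"
    "\<forall>z\<in>A \<times> A. \<forall>x\<in>marked_words A 2.
      (\<forall>Q\<in>Q2. \<forall>p\<in>set [coord 0, coord 1]. \<forall>q\<in>set [coord 0, coord 1].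
        p x \<in> Q \<longleftrightarrow> q x \<in> Q) \<longrightarrow>
      (letter_subst [fst z, snd z] x \<in> L \<longleftrightarrow> letter_subst [snd z, fst z] x \<in> L)"
    using ultrafilter_eqs_uniform_finite_family[OF finAA assms(2) sat2]
    by (elim exE conjE)
  have sat3: "\<forall>z\<in>A \<times> A. satisfies L (ultrafilter_eqs A 3 [coord 0, coord 1, coord 2]
      (letter_subst [fst z, fst z, snd z]) (letter_subst [fst z, snd z, snd z]))"
    using assms(4) by (auto simp: E_aab_abb_def)
  obtain Q3 where Q3: "finite Q3"
    "\<forall>z\<in>A \<times> A. \<forall>x\<in>marked_words A 3.
      (\<forall>Q\<in>Q3. \<forall>p\<in>set [coord 0, coord 1, coord 2]. \<forall>q\<in>set [coord 0, coord 1, coord 2].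
        p x \<in> Q \<longleftrightarrow> q x \<in> Q) \<longrightarrow>
      (letter_subst [fst z, fst z, snd z] x \<in> L \<longleftrightarrow> letter_subst [fst z, snd z, snd z] x \<in> L)"
    using ultrafilter_eqs_uniform_finite_family[OF finAA assms(2) sat3]
    by (elim exE conjE)
  have sat1: "\<forall>a\<in>A. satisfies L (ultrafilter_eqs A 1 [coord 0, word_length]
      (letter_subst [a]) (\<lambda>x. letter_subst [a] x @ [a]))"
    using assms(5) by (auto simp: E_a_aa_def)
  obtain Q1 where Q1: "finite Q1"
    "\<forall>a\<in>A. \<forall>x\<in>marked_words A 1.
      (\<forall>Q\<in>Q1. \<forall>p\<in>set [coord 0, word_length]. \<forall>q\<in>set [coord 0, word_length].
        p x \<in> Q \<longleftrightarrow> q x \<in> Q) \<longrightarrow>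
      (letter_subst [a] x \<in> L \<longleftrightarrow> letter_subst [a] x @ [a] \<in> L)"
    using ultrafilter_eqs_uniform_finite_family[OF assms(1) assms(2) sat1]
    by (elim exE conjE)
  define \<Q> where "\<Q> = Q1 \<union> Q2 \<union> Q3"
  \<comment> \<open>The colour of \<open>i\<close> names its atom in the partition of the natural
    numbers generated by \<open>\<Q>\<close>; positions of equal colour are separated by no member
    of \<open>\<Q>\<close>.\<close>
  define c where "c i = {Q \<in> \<Q>. i \<in> Q}" for i :: nat
  have "finite \<Q>" using Q1(1) Q2(1) Q3(1) by (simp add: \<Q>_def)
  moreover have "range c \<subseteq> Pow \<Q>" by (auto simp: c_def)
  ultimately have fin: "finite (range c)" by (meson finite_Pow_iff finite_subset)
  have same: "i \<in> Q \<longleftrightarrow> j \<in> Q" if "c i = c j" "Q \<in> \<Q>" for i j Q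
    using that by (auto simp: c_def)
  interpret invariant_colouring A L c
  proof
    fix w a b i j
    assume *: "w \<in> lists A" "a \<in> A" "b \<in> A" "i < length w" "j < length w" "i \<noteq> j" "c i = c j"
    have "letter_subst [a, b] (w, [i, j]) \<in> L \<longleftrightarrow> letter_subst [b, a] (w, [i, j]) \<in> L"
      using * same[OF *(7)] by (intro Q2(2)[rule_format, of "(a, b)", unfolded fst_conv snd_conv]) (auto simp: \<Q>_def marked_words_def coord_def)
    then show "w[i := a, j := b] \<in> L \<longleftrightarrow> w[i := b, j := a] \<in> L"
      using * by (simp add: letter_subst_def replace_letters_def)
  next
    fix w a b i j k
    assume *: "w \<in> lists A" "a \<in> A" "b \<in> A" "i < length w" "j < length w" "k < length w"
      "distinct [i, j, k]" "c i = c j" "c j = c k"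
    have "letter_subst [a, a, b] (w, [i, j, k]) \<in> L \<longleftrightarrow> letter_subst [a, b, b] (w, [i, j, k]) \<in> L"
      using * same[OF *(8)] same[OF *(9)]
      by (intro Q3(2)[rule_format, of "(a, b)", unfolded fst_conv snd_conv]) (auto simp: \<Q>_def marked_words_def coord_def)
    then show "w[i := a, j := a, k := b] \<in> L \<longleftrightarrow> w[i := a, j := b, k := b] \<in> L"
      using *(7) by (simp add: letter_subst_def replace_letters_def)
  next
    fix w a i
    assume *: "w \<in> lists A" "a \<in> A" "i < length w" "c i = c (length w)"
    \<comment> \<open>The map \<open>word_length\<close> returns the index that the appended letter
      will occupy, which is why colours are compared at \<open>length w\<close>.\<close>
    have "letter_subst [a] (w, [i]) \<in> L \<longleftrightarrow> letter_subst [a] (w, [i]) @ [a] \<in> L"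
      using * same[OF *(4)] by (intro Q1(2)[rule_format]) (auto simp: \<Q>_def marked_words_def coord_def word_length_def)
    then show "w[i := a] \<in> L \<longleftrightarrow> w[i := a] @ [a] \<in> L"
      by (simp add: letter_subst_def replace_letters_def)
  qed
  show ?thesis by (rule in_B1[OF assms(1,2) fin])
qed

end
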